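(* Let $k\ge 1$, let $G_1,\dots,G_k$ be graphs, let $n$ be a positive integer, and let $K_n=(V,E)$ be the complete graph on $n$ vertices. Consider the following system of polynomial equations over $\overline{\mathbb{F}_2}$ in the variables $x_{i,e}$, $1\le i\le k$, $e\in E$: \begin{align*} p_{H,i} := \prod_{e\in E(H)} x_{i,e} &=0 &&\forall i,\ 1\le i \le k,\quad \forall H\subseteq K_n \text{ with } H \cong G_i,\\ q_e := 1+\sum_{i=1}^k x_{i,e}&= 0 &&\forall e \in E,\\ u_{i,j,e} := x_{i,e}x_{j,e} & = 0 &&\forall e\in E,\ \forall i\neq j. \end{align*} Then $R(G_1,\dots,G_k)\le n$ if and only if this system has no solution over $\overline{\mathbb{F}_2}$. Moreover, when the system has solutions, the number of solutions equals the number of $k$-colorings of the edges of $K_n$ (i.e. edge-colored graphs of order $n$) that contain no copy of $G_i$ in color $i$ for every $i$. In particular, when $k=2$, $G_1=K_r$, $G_2=K_s$, the number of solutions equals $RG(n,r,s)$. Furthermore, for $k=2$, $G_1=K_r$, $G_2=K_s$, let the Ramsey ideal $RI(n,r,s)$ be the ideal of $\overline{\mathbb{F}_2}[x_{1,e},x_{2,e}]_{e\in E(K_n)}$ generated by the polynomials $p_{H,i}$, $q_e$, $u_{i,j,e}$ above. Then $$RI(n,r,s) \supseteq RI(n,r+1,s) \supseteq \dots \supseteq RI(n,n,s) \supseteq RI(n,n+1,s) = RI(n,n+2,s) = \dots$$ and $$RI(n,r,s) \supseteq RI(n,r,s+1) \supseteq \dots \supseteq RI(n,r,n) \supseteq RI(n,r,n+1)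 = RI(n,r,n+2) = \dots.$$
   Context: $R(G_1,\dots,G_k)$ denotes the smallest positive integer $N$ such that every $k$-coloring of the edges of $K_N$ contains, for some $i$, a copy of $G_i$ all of whose edges have color $i$. A Ramsey $(r,s)$-graph is a graph with no clique of size $r$ and no independent set of size $s$; $RG(n,r,s)$ is the number of Ramsey $(r,s)$-graphs on the labeled vertex set $\{1,\dots,n\}$ (not counted up to isomorphism). Here "$H\subseteq K_n$, $H\cong G_i$" ranges over subgraphs of $K_n$ isomorphic to $G_i$. *)

theory Defs
  imports
    "HOL-Library.Ramsey"
    "HOL-Library.FuncSet"
    "HOL-Library.Poly_Mapping"
    "HOL-Library.Z2"
    "HOL-Algebra.Ideal"
    "HOL-Algebra.Algebraic_Closure_Type"
begin

type_synonym 'a ugraph = "'a set \<times> 'a set set"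

abbreviation verts :: "'a ugraph \<Rightarrow> 'a set"
  where "verts \<equiv> fst"

abbreviation edges :: "'a ugraph \<Rightarrow> 'a set set"
  where "edges \<equiv> snd"

definition simple_graph :: "'a ugraph \<Rightarrow> bool"
  where "simple_graph G \<longleftrightarrow> finite (verts G) \<and> edges G \<subseteq> nsets (verts G) 2"

definition subgraph :: "'a ugraph \<Rightarrow> 'a ugraph \<Rightarrow> bool"
  where "subgraph H G \<longleftrightarrow> simple_graph H \<and> verts H \<subseteq> verts G \<and> edges H \<subseteq> edges G"

definition graph_iso :: "'a ugraph \<Rightarrow> 'b ugraph \<Rightarrow> bool"
  where "graph_iso H G \<longleftrightarrow>
    (\<exists>f. bij_betw f (verts H) (verts G) \<and> (image f) ` edges H = edges G)"

definition complete_graph :: "nat \<Rightarrow> nat ugraph"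
  where "complete_graph n = ({1..n}, nsets {1..n} 2)"

definition copies :: "nat \<Rightarrow> 'a ugraph \<Rightarrow> nat ugraph set"
  where "copies n G = {H. subgraph H (complete_graph n) \<and> graph_iso H G}"

text \<open>
  The graphs $G_1,\dots,G_k$ are the values at \<open>1,\<dots>,k\<close> of a function \<open>G\<close> on the natural numbers.
  Colorings, and below assignments of values to variables, are extensional functions, so that
  counting them is meaningful.
\<close>

definition edge_colorings :: "nat \<Rightarrow> nat \<Rightarrow> (nat set \<Rightarrow> nat) set"
  where "edge_colorings k n = (edges (complete_graph n) \<rightarrow>\<^sub>E {1..k})"

definition has_mono_copy :: "nat \<Rightarrow> (nat \<Rightarrow> 'a ugraph) \<Rightarrow> nat \<Rightarrow> (nat set \<Rightarrow> nat) \<Rightarrow> bool"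
  where "has_mono_copy k G n c \<longleftrightarrow>
    (\<exists>i\<in>{1..k}. \<exists>H\<in>copies n (G i). \<forall>e\<in>edges H. c e = i)"

definition ramsey_number :: "nat \<Rightarrow> (nat \<Rightarrow> 'a ugraph) \<Rightarrow> nat"
  where "ramsey_number k G =
    (LEAST N. N \<ge> 1 \<and> (\<forall>c\<in>edge_colorings k N. has_mono_copy k G N c))"

definition good_colorings :: "nat \<Rightarrow> (nat \<Rightarrow> 'a ugraph) \<Rightarrow> nat \<Rightarrow> (nat set \<Rightarrow> nat) set"
  where "good_colorings k G n = {c \<in> edge_colorings k n. \<not> has_mono_copy k G n c}"

text \<open>Ramsey $(r,s)$-graphs on \<open>{1..n}\<close>, identified with their edge sets.\<close>

definition ramsey_graphs :: "nat \<Rightarrow> nat \<Rightarrow> nat \<Rightarrow> nat set set set"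
  where "ramsey_graphs n r s =
    {E. E \<subseteq> nsets {1..n} 2 \<and>
        \<not> (\<exists>A\<subseteq>{1..n}. card A = r \<and> clique A E) \<and>
        \<not> (\<exists>A\<subseteq>{1..n}. card A = s \<and> indep A E)}"

definition RG :: "nat \<Rightarrow> nat \<Rightarrow> nat \<Rightarrow> nat"
  where "RG n r s = card (ramsey_graphs n r s)"

text \<open>
  Multivariate polynomials: a monomial is a finitely supported exponent function, a polynomial a
  finitely supported function from monomials to coefficients; \<open>*\<close> on this type is convolution.
\<close>

type_synonym ('v, 'a) mpoly = "('v \<Rightarrow>\<^sub>0 nat) \<Rightarrow>\<^sub>0 'a"

type_synonym F2bar = "bit alg_closure"

text \<open>The variable $x_{i,e}$ is indexed by the pair \<open>(i, e)\<close>.\<close>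

type_synonym rvar = "nat \<times> nat set"

definition Var :: "'v \<Rightarrow> ('v, 'a::zero_neq_one) mpoly"
  where "Var v = Poly_Mapping.single (Poly_Mapping.single v 1) 1"

definition mpoly_eval :: "('v \<Rightarrow> 'a) \<Rightarrow> ('v, 'a::comm_semiring_1) mpoly \<Rightarrow> 'a"
  where "mpoly_eval a p =
    (\<Sum>m\<in>Poly_Mapping.keys p. Poly_Mapping.lookup p m *
      (\<Prod>v\<in>Poly_Mapping.keys m. a v ^ Poly_Mapping.lookup m v))"

definition mpoly_ring :: "'v set \<Rightarrow> ('v, 'a::comm_ring_1) mpoly ring"
  where "mpoly_ring V =
    \<lparr>carrier = {p. \<forall>m\<in>Poly_Mapping.keys p. Poly_Mapping.keys m \<subseteq> V},
     monoid.mult = (*), one = 1, ring.zero = 0, add = (+)\<rparr>"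

definition ramsey_vars :: "nat \<Rightarrow> nat \<Rightarrow> rvar set"
  where "ramsey_vars k n = {1..k} \<times> edges (complete_graph n)"

definition p_poly :: "nat ugraph \<Rightarrow> nat \<Rightarrow> (rvar, F2bar) mpoly"
  where "p_poly H i = (\<Prod>e\<in>edges H. Var (i, e))"

definition q_poly :: "nat \<Rightarrow> nat set \<Rightarrow> (rvar, F2bar) mpoly"
  where "q_poly k e = 1 + (\<Sum>i\<in>{1..k}. Var (i, e))"

definition u_poly :: "nat \<Rightarrow> nat \<Rightarrow> nat set \<Rightarrow> (rvar, F2bar) mpoly"
  where "u_poly i j e = Var (i, e) * Var (j, e)"

definition ramsey_system :: "nat \<Rightarrow> (nat \<Rightarrow> 'a ugraph) \<Rightarrow> nat \<Rightarrow> (rvar, F2bar) mpoly set"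
  where "ramsey_system k G n =
    {p_poly H i | H i. i \<in> {1..k} \<and> H \<in> copies n (G i)} \<union>
    {q_poly k e | e. e \<in> edges (complete_graph n)} \<union>
    {u_poly i j e | i j e. i \<in> {1..k} \<and> j \<in> {1..k} \<and> i \<noteq> j \<and> e \<in> edges (complete_graph n)}"

definition ramsey_solutions :: "nat \<Rightarrow> (nat \<Rightarrow> 'a ugraph) \<Rightarrow> nat \<Rightarrow> (rvar \<Rightarrow> F2bar) set"
  where "ramsey_solutions k G n =
    {a \<in> ramsey_vars k n \<rightarrow>\<^sub>E UNIV. \<forall>f\<in>ramsey_system k G n. mpoly_eval a f = 0}"

definition complete_pair :: "nat \<Rightarrow> nat \<Rightarrow> nat \<Rightarrow> nat ugraph"
  where "complete_pair r s i = (if i = 1 then complete_graph r else complete_graph s)"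

definition RI :: "nat \<Rightarrow> nat \<Rightarrow> nat \<Rightarrow> (rvar, F2bar) mpoly set"
  where "RI n r s =
    genideal (mpoly_ring (ramsey_vars 2 n)) (ramsey_system 2 (complete_pair r s) n)"

end

theory Submission
  imports Defs
begin

text \<open>
  The equations \<open>u\<^sub>i\<^sub>j\<^sub>e = 0\<close> leave at most one non-zero variable \<open>x\<^sub>i\<^sub>e\<close> for each edge \<open>e\<close>, and
  \<open>q\<^sub>e = 0\<close> forces that variable to exist and to equal \<open>1\<close>, since the characteristic is two.
  Hence solutions are exactly the indicator functions of colorings, and \<open>p\<^sub>H\<^sub>i = 0\<close> says that \<open>H\<close>
  is not monochromatic in color \<open>i\<close>.  Ramsey's theorem makes the minimum in the definition of the
  Ramsey number an honest one.  The inclusions between the ideals hold because a copy of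
  \<open>K\<^sub>m\<^sub>+\<^sub>1\<close> contains a copy of \<open>K\<^sub>m\<close>, so that its monomial is a multiple of the smaller one; there
  are no copies at all once \<open>m > n\<close>.
\<close>

subsection \<open>Evaluation of polynomials\<close>

lemma poly_mapping_sum_single:
  "(\<Sum>m\<in>Poly_Mapping.keys p. Poly_Mapping.single m (Poly_Mapping.lookup p m)) = p"
proof (rule poly_mapping_eqI)
  fix k
  have "Poly_Mapping.lookup (\<Sum>m\<in>Poly_Mapping.keys p. Poly_Mapping.single m (Poly_Mapping.lookup p m)) k
      = (\<Sum>m\<in>Poly_Mapping.keys p. if m = k then Poly_Mapping.lookup p m else 0)"
    by (simp add: lookup_sum lookup_single when_def)
  then show "Poly_Mapping.lookup (\<Sum>m\<in>Poly_Mapping.keys p. Poly_Mapping.single m (Poly_Mapping.lookup p m)) k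
      = Poly_Mapping.lookup p k"
    by (simp add: in_keys_iff)
qed

text \<open>Monomials outside the support carry coefficient 0. With this, \<open>p\<close>,
  \<open>q\<close> and \<open>p + q\<close> can be summed over one common index set, although
  cancellation may shrink the support of the sum.\<close>

lemma mpoly_eval_superset:
  assumes "finite S" "Poly_Mapping.keys p \<subseteq> S"
  shows "mpoly_eval a p = (\<Sum>m\<in>S. Poly_Mapping.lookup p m *
    (\<Prod>v\<in>Poly_Mapping.keys m. a v ^ Poly_Mapping.lookup m v))"
  unfolding mpoly_eval_def
  by (rule sum.mono_neutral_left) (use assms in \<open>auto simp: in_keys_iff\<close>)

lemma mpoly_eval_add: "mpoly_eval a (p + q) = mpoly_eval a p + mpoly_eval a q"
  using mpoly_eval_superset[of "Poly_Mapping.keys p \<union> Poly_Mapping.keys q" _ a]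
  by (simp add: keys_add lookup_add distrib_right sum.distrib)

lemma mpoly_eval_0 [simp]: "mpoly_eval a 0 = 0"
  by (simp add: mpoly_eval_def)

lemma mpoly_eval_sum: "mpoly_eval a (\<Sum>i\<in>I. f i) = (\<Sum>i\<in>I. mpoly_eval a (f i))"
  by (induction I rule: infinite_finite_induct) (simp_all add: mpoly_eval_add)

lemma mpoly_eval_single:
  "mpoly_eval a (Poly_Mapping.single m c)
     = c * (\<Prod>v\<in>Poly_Mapping.keys m. a v ^ Poly_Mapping.lookup m v)"
  by (simp add: mpoly_eval_def)

lemma prod_power_lookup_superset:
  fixes a :: "'v \<Rightarrow> 'a::comm_monoid_mult"
  assumes "finite S" "Poly_Mapping.keys m \<subseteq> S"
  shows "(\<Prod>v\<in>Poly_Mapping.keys m. a v ^ Poly_Mapping.lookup m v)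
    = (\<Prod>v\<in>S. a v ^ Poly_Mapping.lookup m v)"
  by (rule prod.mono_neutral_left) (use assms in \<open>auto simp: in_keys_iff\<close>)

text \<open>Taken over the union of both supports, the powers split factor by factor, since missing
  variables contribute exponent 0.\<close>

lemma prod_power_lookup_add:
  fixes a :: "'v \<Rightarrow> 'a::comm_monoid_mult"
  shows "(\<Prod>v\<in>Poly_Mapping.keys (m + m'). a v ^ Poly_Mapping.lookup (m + m') v)
    = (\<Prod>v\<in>Poly_Mapping.keys m. a v ^ Poly_Mapping.lookup m v) *
      (\<Prod>v\<in>Poly_Mapping.keys m'. a v ^ Poly_Mapping.lookup m' v)"
proof -
  let ?S = "Poly_Mapping.keys m \<union> Poly_Mapping.keys m'"
  have "(\<Prod>v\<in>Poly_Mapping.keys l. a v ^ Poly_Mapping.lookup l v)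
      = (\<Prod>v\<in>?S. a v ^ Poly_Mapping.lookup l v)" if "Poly_Mapping.keys l \<subseteq> ?S" for l
    using that by (intro prod_power_lookup_superset) simp
  from this[of m] this[of m'] this[of "m + m'"] show ?thesis
    using keys_add[of m m'] by (simp only: Un_upper1 Un_upper2 lookup_add power_add prod.distrib)
qed

text \<open>Both sides are biadditive, so writing \<open>p\<close> and \<open>q\<close> as sums of
  their terms reduces the claim to a product of two single terms.\<close>

lemma mpoly_eval_mult: "mpoly_eval a (p * q) = mpoly_eval a p * mpoly_eval a q"
proof -
  define P where "P = (\<lambda>p m. Poly_Mapping.single m (Poly_Mapping.lookup p m) :: ('b, 'a) mpoly)"
  have expand: "(\<Sum>m\<in>Poly_Mapping.keys r. P r m) = r" for r
    unfolding P_def by (rule poly_mapping_sum_single)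
  have "mpoly_eval a (P p m * P q m') = mpoly_eval a (P p m) * mpoly_eval a (P q m')" for m m'
    by (simp add: P_def mult_single mpoly_eval_single prod_power_lookup_add mult_ac)
  then have "mpoly_eval a ((\<Sum>m\<in>Poly_Mapping.keys p. P p m) * (\<Sum>m\<in>Poly_Mapping.keys q. P q m))
     = mpoly_eval a (\<Sum>m\<in>Poly_Mapping.keys p. P p m) * mpoly_eval a (\<Sum>m\<in>Poly_Mapping.keys q. P q m)"
    by (simp add: sum_product mpoly_eval_sum)
  then show ?thesis by (simp add: expand)
qed

lemma mpoly_eval_1 [simp]: "mpoly_eval a 1 = 1"
  by (simp add: mpoly_eval_def lookup_one)

lemma mpoly_eval_prod: "mpoly_eval a (\<Prod>i\<in>I. f i) = (\<Prod>i\<in>I. mpoly_eval a (f i))"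
  by (induction I rule: infinite_finite_induct) (simp_all add: mpoly_eval_mult)

lemma mpoly_eval_Var [simp]: "mpoly_eval a (Var v) = a v"
  by (simp add: Var_def mpoly_eval_single)

subsection \<open>The polynomial ring\<close>

lemma mpoly_ring_simps [simp]:
  "p \<in> carrier (mpoly_ring V) \<longleftrightarrow> (\<forall>m\<in>Poly_Mapping.keys p. Poly_Mapping.keys m \<subseteq> V)"
  "p \<otimes>\<^bsub>mpoly_ring V\<^esub> q = p * q" "p \<oplus>\<^bsub>mpoly_ring V\<^esub> q = p + q"
  "\<one>\<^bsub>mpoly_ring V\<^esub> = 1" "\<zero>\<^bsub>mpoly_ring V\<^esub> = 0"
  by (simp_all add: mpoly_ring_def)

lemma mpoly_ring_add_closed:
  assumes "p \<in> carrier (mpoly_ring V)" "q \<in> carrier (mpoly_ring V)"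
  shows "p + q \<in> carrier (mpoly_ring V)"
  using assms keys_add[of p q] by auto

lemma mpoly_ring_mult_closed:
  assumes "p \<in> carrier (mpoly_ring V)" "q \<in> carrier (mpoly_ring V)"
  shows "p * q \<in> carrier (mpoly_ring V)"
  unfolding mpoly_ring_simps
proof
  fix m assume "m \<in> Poly_Mapping.keys (p * q)"
  then obtain b c where "m = b + c" "b \<in> Poly_Mapping.keys p" "c \<in> Poly_Mapping.keys q"
    using keys_mult[of p q] by auto
  then show "Poly_Mapping.keys m \<subseteq> V"
    using assms keys_add[of b c] by fastforce
qed

text \<open>The ring laws are inherited from the type of polynomials; only closure of the carrier
  under the operations needs an argument. This gives access to the theory of ideals.\<close>

lemma mpoly_ring_cring: "cring (mpoly_ring V :: ('v, 'a::comm_ring_1) mpoly ring)"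
proof (rule cringI)
  show "abelian_group (mpoly_ring V :: ('v, 'a) mpoly ring)"
  proof (rule abelian_groupI)
    fix p :: "('v, 'a) mpoly" assume "p \<in> carrier (mpoly_ring V)"
    then show "\<exists>q\<in>carrier (mpoly_ring V). q \<oplus>\<^bsub>mpoly_ring V\<^esub> p = \<zero>\<^bsub>mpoly_ring V\<^esub>"
      by (intro bexI[of _ "-p"]) (auto simp: in_keys_iff)
  next
    fix p q :: "('v, 'a) mpoly"
    assume "p \<in> carrier (mpoly_ring V)" "q \<in> carrier (mpoly_ring V)"
    then show "p \<oplus>\<^bsub>mpoly_ring V\<^esub> q \<in> carrier (mpoly_ring V)"
      using mpoly_ring_add_closed by (simp only: mpoly_ring_simps(3))
  qed (simp_all add: add_ac)
  show "Group.comm_monoid (mpoly_ring V :: ('v, 'a) mpoly ring)"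
  proof (rule comm_monoidI)
    fix p q :: "('v, 'a) mpoly"
    assume "p \<in> carrier (mpoly_ring V)" "q \<in> carrier (mpoly_ring V)"
    then show "p \<otimes>\<^bsub>mpoly_ring V\<^esub> q \<in> carrier (mpoly_ring V)"
      using mpoly_ring_mult_closed by (simp only: mpoly_ring_simps(2))
  qed (simp_all add: mult_ac)
qed (simp add: distrib_right)

lemma mpoly_ring_sum_closed:
  "(\<And>i. i \<in> I \<Longrightarrow> f i \<in> carrier (mpoly_ring V)) \<Longrightarrow> (\<Sum>i\<in>I. f i) \<in> carrier (mpoly_ring V)"
proof (induction I rule: infinite_finite_induct)
  case (insert i I)
  then show ?case using mpoly_ring_add_closed[of "f i" V "sum f I"]
    by (simp only: sum.insert insert_iff simp_thms)
qed simp_all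

lemma mpoly_ring_prod_closed:
  "(\<And>i. i \<in> I \<Longrightarrow> f i \<in> carrier (mpoly_ring V)) \<Longrightarrow> (\<Prod>i\<in>I. f i) \<in> carrier (mpoly_ring V)"
proof (induction I rule: infinite_finite_induct)
  case (insert i I)
  then show ?case using mpoly_ring_mult_closed[of "f i" V "prod f I"]
    by (simp only: prod.insert insert_iff simp_thms)
qed simp_all

lemma Var_closed: "v \<in> V \<Longrightarrow> Var v \<in> carrier (mpoly_ring V)"
  by (simp add: Var_def)

subsection \<open>Copies of graphs and Ramsey numbers\<close>

lemma edges_complete_graph [simp]: "edges (complete_graph n) = nsets {1..n} 2"
  and verts_complete_graph [simp]: "verts (complete_graph n) = {1..n}"
  by (simp_all add: complete_graph_def)

lemma copies_edges:
  assumes "H \<in> copies n G"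
  shows "edges H \<subseteq> nsets {1..n} 2" "finite (edges H)"
proof -
  show "edges H \<subseteq> nsets {1..n} 2"
    using assms by (simp add: copies_def subgraph_def)
  then show "finite (edges H)"
    by (rule finite_subset) (simp add: finite_imp_finite_nsets)
qed

lemma copies_mono: "m \<le> n \<Longrightarrow> copies m G \<subseteq> copies n G"
  using nsets_mono[of "{1..m}" "{1..n}" 2] by (fastforce simp: copies_def subgraph_def)

lemma image_nsets:
  assumes "inj_on f A"
  shows "image f ` nsets A k = nsets (f ` A) k"
  using bij_betw_nsets[of f A "f ` A" k] assms by (simp add: bij_betw_def)

text \<open>Transporting \<open>G\<close> along a bijection onto \<open>W\<close> gives the copy.
  Hence a monochromatic clique with as many vertices as \<open>G\<close> contains a monochromatic
  copy of \<open>G\<close>.\<close>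

lemma copy_on_vertex_set:
  assumes G: "simple_graph G" and W: "W \<subseteq> {1..n}" "card W = card (verts G)"
  shows "\<exists>H\<in>copies n G. edges H \<subseteq> nsets W 2"
proof -
  have fin: "finite (verts G)" "edges G \<subseteq> nsets (verts G) 2"
    using G by (auto simp: simple_graph_def)
  have "finite W" using W(1) finite_subset by blast
  then obtain g where g: "bij_betw g (verts G) W"
    using fin W(2) finite_same_card_bij by metis
  then have inj: "inj_on g (verts G)" and img: "g ` verts G = W"
    by (auto simp: bij_betw_def)
  \<comment> \<open>An isomorphism in \<open>graph_iso H G\<close> runs from the copy to
    \<open>G\<close>, opposite to the map \<open>g\<close> that builds the copy.\<close>
  define f where "f = inv_into (verts G) g"
  define H where "H = (W, image g ` edges G)"
  have sub: "edges H \<subseteq> nsets W 2"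
    using image_mono[OF fin(2), of "image g"] image_nsets[OF inj, of 2] img by (simp add: H_def)
  have "f ` g ` e = e" if "e \<in> edges G" for e
    using that fin(2) inj unfolding f_def
    by (intro inv_into_image_cancel) (auto simp: nsets_def)
  then have "(image f) ` edges H = edges G"
    by (simp add: H_def image_image)
  moreover have "bij_betw f W (verts G)"
    unfolding f_def using g by (rule bij_betw_inv_into)
  ultimately have "graph_iso H G"
    by (auto simp: graph_iso_def H_def)
  moreover have "subgraph H (complete_graph n)"
    using sub W(1) \<open>finite W\<close> nsets_mono[OF W(1), of 2]
    by (simp add: subgraph_def simple_graph_def H_def)
  ultimately have "H \<in> copies n G"
    by (simp add: copies_def)
  then show ?thesis
    using sub by (rule bexI[rotated])
qed

section \<open>Monotonicity in the number of vertices, and finiteness of Ramsey numbers\<close>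

lemma has_mono_copy_mono:
  assumes "m \<le> n" "has_mono_copy k G m c"
  shows "has_mono_copy k G n c"
  using assms copies_mono[OF assms(1)] unfolding has_mono_copy_def by (meson subsetD)

lemma has_mono_copy_restrict:
  "has_mono_copy k G n (restrict c (nsets {1..n} 2)) \<longleftrightarrow> has_mono_copy k G n c"
proof -
  have "(\<forall>e\<in>edges H. restrict c (nsets {1..n} 2) e = i) \<longleftrightarrow> (\<forall>e\<in>edges H. c e = i)"
    if "H \<in> copies n (G i)" for H i
    using copies_edges(1)[OF that] by auto
  then show ?thesis unfolding has_mono_copy_def by auto
qed

text \<open>A coloring of the larger complete graph restricts to the smaller one, and a
  monochromatic copy found there survives. This upward closure turns a least number into a
  threshold.\<close>

lemma all_colorings_mono_copy_mono:
  assumes "m \<le> n" "\<forall>c\<in>edge_colorings k m. has_mono_copy k G m c"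
  shows "\<forall>c\<in>edge_colorings k n. has_mono_copy k G n c"
proof
  fix c assume "c \<in> edge_colorings k n"
  then have "restrict c (nsets {1..m} 2) \<in> edge_colorings k m"
    using nsets_mono[of "{1..m}" "{1..n}" 2] assms(1) by (auto simp: edge_colorings_def)
  then show "has_mono_copy k G n c"
    using assms has_mono_copy_restrict has_mono_copy_mono by blast
qed

text \<open>Ramsey's theorem is applied with clique sizes equal to the orders of the
  \<open>G i\<close>; the monochromatic clique it yields is large enough to hold a copy of the graph
  of its color.\<close>

lemma ramsey_number_exists:
  assumes G: "\<And>i. i \<in> {1..k} \<Longrightarrow> simple_graph (G i)"
  shows "\<exists>N\<ge>1. \<forall>c\<in>edge_colorings k N. has_mono_copy k G N c"
proof -
  define qs where "qs = map (\<lambda>i. card (verts (G (Suc i)))) [0..<k]"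
  obtain N :: nat where N: "partn_lst {..<N} qs 2"
    using ramsey_full by blast
  have "has_mono_copy k G N c" if c: "c \<in> edge_colorings k N" for c
  proof -
    \<comment> \<open>Ramsey's theorem numbers vertices and colors from 0, the colorings here from
      1; \<open>f\<close> shifts both.\<close>
    define f where "f = (\<lambda>e. c (Suc ` e) - 1)"
    have Suc_img: "Suc ` {..<N} = {1..N}"
      by (simp add: image_Suc_lessThan)
    have shift: "Suc ` e \<in> nsets {1..N} 2" if "e \<in> nsets {..<N} 2" for e
      using that image_nsets[of Suc "{..<N}" 2] Suc_img by auto
    have range: "c (Suc ` e) \<in> {1..k}" if "e \<in> nsets {..<N} 2" for e
      using c shift[OF that] by (auto simp: edge_colorings_def PiE_iff)
    have "f \<in> nsets {..<N} 2 \<rightarrow> {..<k}"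
      using range by (fastforce simp: f_def)
    then obtain i U where i: "i < k" and U: "U \<in> nsets {..<N} (qs ! i)"
      and mono: "f ` nsets U 2 \<subseteq> {i}"
      using N by (elim partn_lstE[where l = k]) (auto simp: qs_def)
    have UN: "U \<subseteq> {..<N}" "card (Suc ` U) = card (verts (G (Suc i)))"
      using U i by (auto simp: nsets_def qs_def card_image)
    then have "Suc ` U \<subseteq> {1..N}"
      using image_mono[of U "{..<N}" Suc] Suc_img by simp
    moreover have "simple_graph (G (Suc i))"
      using i by (intro G) simp
    ultimately have "\<exists>H\<in>copies N (G (Suc i)). edges H \<subseteq> nsets (Suc ` U) 2"
      using UN(2) by (intro copy_on_vertex_set)
    then obtain H where H: "H \<in> copies N (G (Suc i))" "edges H \<subseteq> nsets (Suc ` U) 2"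
      by blast
    have "c e = Suc i" if "e \<in> edges H" for e
    proof -
      have "e \<in> image Suc ` nsets U 2"
        using that H(2) image_nsets[of Suc U 2] by (simp add: subset_iff)
      then obtain d where d: "d \<in> nsets U 2" "e = Suc ` d"
        by blast
      then have "f d = i" "c e \<in> {1..k}"
        using mono range[of d] nsets_mono[OF UN(1), of 2] by auto
      then show ?thesis using d(2) by (auto simp: f_def)
    qed
    then show ?thesis
      using H(1) i unfolding has_mono_copy_def by (intro bexI[of _ "Suc i"] bexI[of _ H]) auto
  qed
  \<comment> \<open>\<open>N\<close> might be 0, while a Ramsey number has to be positive; passing
    to \<open>Suc N\<close> is harmless by monotonicity.\<close>
  then have "\<forall>c\<in>edge_colorings k (Suc N). has_mono_copy k G (Suc N) c"
    by (intro all_colorings_mono_copy_mono[of N "Suc N"] ballI) simp_all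
  then show ?thesis by (intro exI[of _ "Suc N"]) simp
qed

text \<open>The least number has the defining property because some number does, and the property is
  upward closed.\<close>

lemma ramsey_number_le_iff:
  assumes "n \<ge> 1" and "\<And>i. i \<in> {1..k} \<Longrightarrow> simple_graph (G i)"
  shows "ramsey_number k G \<le> n \<longleftrightarrow> good_colorings k G n = {}"
proof -
  let ?P = "\<lambda>N. N \<ge> 1 \<and> (\<forall>c\<in>edge_colorings k N. has_mono_copy k G N c)"
  have "?P (ramsey_number k G)"
    unfolding ramsey_number_def using ramsey_number_exists[OF assms(2)] by (rule LeastI_ex)
  then have "ramsey_number k G \<le> n \<longleftrightarrow> ?P n"
    using all_colorings_mono_copy_mono[of "ramsey_number k G" n k G] assms(1)
    by (auto simp: ramsey_number_def intro: Least_le)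
  then show ?thesis
    using assms(1) by (auto simp: good_colorings_def)
qed

subsection \<open>Solutions and colorings\<close>

text \<open>Characteristic two passes from the prime field to its closure through the embedding
  \<open>to_ac\<close>.\<close>

lemma F2bar_add_self: "x + x = (0 :: F2bar)"
proof -
  have "(1 :: F2bar) + 1 = to_ac (1 + 1)"
    by (simp only: to_ac_add to_ac_1)
  then have "(1 :: F2bar) + 1 = 0" by simp
  then have "x * (1 + 1) = 0" by (simp only: mult_zero_right)
  then show ?thesis by (simp only: distrib_left mult_1_right)
qed

lemma F2bar_add_eq_0_iff: "x + y = 0 \<longleftrightarrow> y = (x :: F2bar)"
  by (metis F2bar_add_self add_left_imp_eq)

lemma ramsey_system_zero_iff:
  "(\<forall>f\<in>ramsey_system k G n. mpoly_eval a f = 0) \<longleftrightarrow>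
    (\<forall>i\<in>{1..k}. \<forall>H\<in>copies n (G i). \<exists>e\<in>edges H. a (i, e) = 0) \<and>
    (\<forall>e\<in>nsets {1..n} 2. (\<Sum>i\<in>{1..k}. a (i, e)) = 1) \<and>
    (\<forall>e\<in>nsets {1..n} 2. \<forall>i\<in>{1..k}. \<forall>j\<in>{1..k}. i \<noteq> j \<longrightarrow> a (i, e) * a (j, e) = 0)"
proof -
  \<comment> \<open>If \<open>H\<close> has no edges, the product is 1 and never vanishes, which
    matches \<open>H\<close> being vacuously monochromatic in every color.\<close>
  have p: "mpoly_eval a (p_poly H i) = 0 \<longleftrightarrow> (\<exists>e\<in>edges H. a (i, e) = 0)"
    if "H \<in> copies n (G i)" for H i
    using copies_edges(2)[OF that] by (simp add: p_poly_def mpoly_eval_prod)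
  have q: "mpoly_eval a (q_poly k e) = 0 \<longleftrightarrow> (\<Sum>i\<in>{1..k}. a (i, e)) = 1" for e
    by (simp add: q_poly_def mpoly_eval_add mpoly_eval_sum F2bar_add_eq_0_iff)
  have u: "mpoly_eval a (u_poly i j e) = a (i, e) * a (j, e)" for i j e
    by (simp add: u_poly_def mpoly_eval_mult)
  have "(\<forall>f\<in>ramsey_system k G n. mpoly_eval a f = 0) \<longleftrightarrow>
    (\<forall>i\<in>{1..k}. \<forall>H\<in>copies n (G i). mpoly_eval a (p_poly H i) = 0) \<and>
    (\<forall>e\<in>nsets {1..n} 2. mpoly_eval a (q_poly k e) = 0) \<and>
    (\<forall>e\<in>nsets {1..n} 2. \<forall>i\<in>{1..k}. \<forall>j\<in>{1..k}. i \<noteq> j \<longrightarrow> mpoly_eval a (u_poly i j e) = 0)"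
    unfolding ramsey_system_def edges_complete_graph by blast
  then show ?thesis
    using p q u by simp
qed

text \<open>Some summand is non-zero because the sum is; without zero divisors, orthogonality kills
  all others, so the surviving summand is the whole sum, namely 1.\<close>

lemma sum_one_orthogonal:
  fixes x :: "'i \<Rightarrow> 'a::idom"
  assumes "finite I" "(\<Sum>i\<in>I. x i) = 1"
    and "\<And>i j. i \<in> I \<Longrightarrow> j \<in> I \<Longrightarrow> i \<noteq> j \<Longrightarrow> x i * x j = 0"
  obtains i where "i \<in> I" "\<And>j. j \<in> I \<Longrightarrow> x j = (if j = i then 1 else 0)"
proof -
  obtain i where i: "i \<in> I" "x i \<noteq> 0"
    using assms(2) by (metis sum.neutral zero_neq_one)
  then have z: "x j = 0" if "j \<in> I" "j \<noteq> i" for j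
    using assms(3)[of i j] that by auto
  have "(\<Sum>j\<in>I. x j) = x i"
    using assms(1) i(1) z by (subst sum.remove[of _ i]) (auto intro!: sum.neutral)
  then show thesis
    using that[of i] i z assms(2) by auto
qed

text \<open>The indicator vector of a coloring, kept extensional so that it can be counted among the
  solutions.\<close>

definition coloring_point :: "nat \<Rightarrow> nat \<Rightarrow> (nat set \<Rightarrow> nat) \<Rightarrow> rvar \<Rightarrow> F2bar"
  where "coloring_point k n c = (\<lambda>(i, e)\<in>ramsey_vars k n. if c e = i then 1 else 0)"

lemma coloring_point_apply:
  "i \<in> {1..k} \<Longrightarrow> e \<in> nsets {1..n} 2 \<Longrightarrow> coloring_point k n c (i, e) = (if c e = i then 1 else 0)"
  by (auto simp: coloring_point_def ramsey_vars_def)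

lemma inj_on_coloring_point: "inj_on (coloring_point k n) (edge_colorings k n)"
proof (rule inj_onI)
  fix c d assume c: "c \<in> edge_colorings k n" and d: "d \<in> edge_colorings k n"
    and eq: "coloring_point k n c = coloring_point k n d"
  show "c = d"
  proof (rule PiE_ext[OF c[unfolded edge_colorings_def] d[unfolded edge_colorings_def]])
    fix e assume "e \<in> edges (complete_graph n)"
    then have e: "e \<in> nsets {1..n} 2" and "c e \<in> {1..k}"
      using c by (auto simp: edge_colorings_def PiE_iff)
    \<comment> \<open>Both points are compared at the coordinate \<open>(c e, e)\<close>, where the
      point of \<open>c\<close> has value 1.\<close>
    then have "(if d e = c e then 1 else (0 :: F2bar)) = 1"
      using eq coloring_point_apply[of "c e" k e n] by metis
    then show "c e = d e" by (simp split: if_splits)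
  qed
qed

text \<open>The equations from \<open>q_poly\<close> and \<open>u_poly\<close> hold at the point of
  any coloring, as each edge has exactly one color; only those from \<open>p_poly\<close> restrict
  the coloring.\<close>

lemma coloring_point_solution_iff:
  assumes c: "c \<in> edge_colorings k n"
  shows "coloring_point k n c \<in> ramsey_solutions k G n \<longleftrightarrow> \<not> has_mono_copy k G n c"
proof -
  let ?a = "coloring_point k n c"
  have q: "(\<Sum>i\<in>{1..k}. ?a (i, e)) = 1" if e: "e \<in> nsets {1..n} 2" for e
  proof -
    have "c e \<in> {1..k}" using c e by (auto simp: edge_colorings_def PiE_iff)
    have "(\<Sum>i\<in>{1..k}. ?a (i, e)) = (\<Sum>i\<in>{1..k}. if c e = i then 1 else 0)"
      using e by (intro sum.cong) (simp_all add: coloring_point_apply)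
    then show ?thesis using \<open>c e \<in> {1..k}\<close> by simp
  qed
  have u: "?a (i, e) * ?a (j, e) = 0"
    if "e \<in> nsets {1..n} 2" "i \<in> {1..k}" "j \<in> {1..k}" "i \<noteq> j" for e i j
    using that by (simp add: coloring_point_apply)
  have p: "(\<exists>e\<in>edges H. ?a (i, e) = 0) \<longleftrightarrow> \<not> (\<forall>e\<in>edges H. c e = i)"
    if "i \<in> {1..k}" "H \<in> copies n (G i)" for i H
  proof -
    have "?a (i, e) = 0 \<longleftrightarrow> c e \<noteq> i" if "e \<in> edges H" for e
      using coloring_point_apply[OF \<open>i \<in> {1..k}\<close>, of e n c]
        copies_edges(1)[OF \<open>H \<in> copies n (G i)\<close>] that by auto
    then show ?thesis by blast
  qed
  have "?a \<in> ramsey_vars k n \<rightarrow>\<^sub>E UNIV"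
    by (simp add: coloring_point_def)
  then have "?a \<in> ramsey_solutions k G n \<longleftrightarrow>
      (\<forall>i\<in>{1..k}. \<forall>H\<in>copies n (G i). \<exists>e\<in>edges H. ?a (i, e) = 0)"
    unfolding ramsey_solutions_def mem_Collect_eq ramsey_system_zero_iff using q u by blast
  also have "\<dots> \<longleftrightarrow> (\<forall>i\<in>{1..k}. \<forall>H\<in>copies n (G i). \<not> (\<forall>e\<in>edges H. c e = i))"
    using p by (intro ball_cong refl)
  finally show ?thesis
    by (simp add: has_mono_copy_def)
qed

text \<open>On each edge the equations single out exactly one color with coordinate 1, by
  \<open>sum_one_orthogonal\<close>; these choices form the coloring.\<close>

lemma solution_is_coloring_point:
  assumes a: "a \<in> ramsey_solutions k G n"
  shows "\<exists>c\<in>edge_colorings k n. a = coloring_point k n c"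
proof -
  have ext: "a \<in> ramsey_vars k n \<rightarrow>\<^sub>E UNIV"
    and sys: "\<forall>f\<in>ramsey_system k G n. mpoly_eval a f = 0"
    using a by (simp_all add: ramsey_solutions_def)
  have "\<exists>i. i \<in> {1..k} \<and> (\<forall>j\<in>{1..k}. a (j, e) = (if j = i then 1 else 0))"
    if "e \<in> nsets {1..n} 2" for e
    by (rule sum_one_orthogonal[of "{1..k}" "\<lambda>i. a (i, e)"])
      (use sys[unfolded ramsey_system_zero_iff] that in auto)
  then obtain c where c: "\<And>e. e \<in> nsets {1..n} 2 \<Longrightarrow> c e \<in> {1..k}"
    "\<And>e j. e \<in> nsets {1..n} 2 \<Longrightarrow> j \<in> {1..k} \<Longrightarrow> a (j, e) = (if j = c e then 1 else 0)"
    by metis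
  \<comment> \<open>The chosen \<open>c\<close> is arbitrary off the edges, so it is made
    extensional.\<close>
  define d where "d = restrict c (nsets {1..n} 2)"
  have "d \<in> edge_colorings k n"
    using c(1) by (auto simp: d_def edge_colorings_def)
  moreover have "a = coloring_point k n d"
  proof (rule PiE_ext[OF ext])
    show "coloring_point k n d \<in> ramsey_vars k n \<rightarrow>\<^sub>E UNIV"
      by (simp add: coloring_point_def)
    fix v assume "v \<in> ramsey_vars k n"
    then show "a v = coloring_point k n d v"
      using c(2) by (auto simp: ramsey_vars_def coloring_point_apply d_def)
  qed
  ultimately show ?thesis by blast
qed

lemma bij_betw_coloring_point:
  "bij_betw (coloring_point k n) (good_colorings k G n) (ramsey_solutions k G n)"
proof (rule bij_betw_imageI)
  show "inj_on (coloring_point k n) (good_colorings k G n)"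
    by (rule inj_on_subset[OF inj_on_coloring_point]) (auto simp: good_colorings_def)
  show "coloring_point k n ` good_colorings k G n = ramsey_solutions k G n"
    unfolding good_colorings_def
    using coloring_point_solution_iff[of _ k n G] solution_is_coloring_point[of _ k G n] by blast
qed

lemma finite_good_colorings: "finite (good_colorings k G n)"
proof (rule finite_subset)
  show "good_colorings k G n \<subseteq> edge_colorings k n"
    by (auto simp: good_colorings_def)
  show "finite (edge_colorings k n)"
    by (simp add: edge_colorings_def finite_PiE finite_imp_finite_nsets)
qed

subsection \<open>Two colors and complete graphs\<close>

text \<open>A bijection of vertices induces a bijection of all pairs, so a copy of a complete graph
  must contain every pair of its vertices and is determined by its vertex set.\<close>

lemma copies_complete_graph: "copies n (complete_graph m) = (\<lambda>A. (A, nsets A 2)) ` nsets {1..n} m"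
proof (intro equalityI subsetI)
  fix H assume H: "H \<in> copies n (complete_graph m)"
  then obtain f where f: "bij_betw f (verts H) {1..m}"
    and fe: "(image f) ` edges H = nsets {1..m} 2"
    and sub: "verts H \<subseteq> {1..n}" "edges H \<subseteq> nsets (verts H) 2"
    by (auto simp: copies_def graph_iso_def subgraph_def simple_graph_def)
  have inj: "inj_on f (verts H)" using f by (rule bij_betw_imp_inj_on)
  have "bij_betw (image f) (nsets (verts H) 2) (nsets {1..m} 2)"
    using f by (rule bij_betw_nsets)
  then have "edges H = nsets (verts H) 2"
    using fe sub(2) by (metis bij_betw_def inj_on_image_eq_iff subset_refl)
  moreover have "verts H \<in> nsets {1..n} m"
    using sub(1) bij_betw_same_card[OF f] finite_subset[OF sub(1)] by (auto simp: nsets_def)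
  ultimately show "H \<in> (\<lambda>A. (A, nsets A 2)) ` nsets {1..n} m"
    by (intro image_eqI[of _ _ "verts H"]) (simp_all add: prod_eq_iff)
next
  fix H assume "H \<in> (\<lambda>A. (A, nsets A 2)) ` nsets {1..n} m"
  then obtain A where A: "H = (A, nsets A 2)" "A \<subseteq> {1..n}" "finite A" "card A = m"
    by (auto simp: nsets_def)
  then obtain f where f: "bij_betw f A {1..m}"
    using finite_same_card_bij[of A "{1..m}"] by auto
  then have "graph_iso H (complete_graph m)"
    unfolding graph_iso_def using bij_betw_imp_surj_on[OF bij_betw_nsets[OF f, of 2]]
    by (intro exI[of _ f]) (simp add: A(1))
  then show "H \<in> copies n (complete_graph m)"
    using A nsets_mono[OF A(2), of 2] by (simp add: copies_def subgraph_def simple_graph_def)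
qed

lemma has_mono_copy_complete_pair:
  "has_mono_copy 2 (complete_pair r s) n c \<longleftrightarrow>
    (\<exists>A\<subseteq>{1..n}. card A = r \<and> (\<forall>e\<in>nsets A 2. c e = 1)) \<or>
    (\<exists>A\<subseteq>{1..n}. card A = s \<and> (\<forall>e\<in>nsets A 2. c e = 2))"
proof -
  have nsets_iff: "A \<in> nsets {1..n} m \<longleftrightarrow> A \<subseteq> {1..n} \<and> card A = m" for A m
    by (auto simp: nsets_def intro: finite_subset[OF _ finite_atLeastAtMost])
  have ex_nsets: "(\<exists>A\<in>nsets {1..n} m. P A) \<longleftrightarrow> (\<exists>A\<subseteq>{1..n}. card A = m \<and> P A)" for m P
    unfolding Bex_def nsets_iff by (simp only: conj_assoc)
  have "{1..2::nat} = {1, 2}" by auto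
  then show ?thesis
    by (simp add: has_mono_copy_def complete_pair_def copies_complete_graph ex_nsets
        del: One_nat_def)
qed

section \<open>Two-colorings as graphs, with cliques and independent sets\<close>

lemma clique_iff_nsets: "clique A E \<longleftrightarrow> nsets A 2 \<subseteq> E"
  by (auto simp: clique_def nsets_2_eq)

lemma indep_iff_nsets: "indep A E \<longleftrightarrow> nsets A 2 \<inter> E = {}"
  by (auto simp: indep_def nsets_2_eq)

text \<open>The edges of color 1 form the graph and those of color 2 its complement, so cliques in
  color 2 become independent sets.\<close>

lemma bij_betw_color_class:
  "bij_betw (\<lambda>c. {e \<in> nsets {1..n} 2. c e = 1})
     (good_colorings 2 (complete_pair r s) n) (ramsey_graphs n r s)"
proof -
  define F where "F = (\<lambda>c :: nat set \<Rightarrow> nat. {e \<in> nsets {1..n} 2. c e = 1})"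
  \<comment> \<open>The inverse of \<open>F\<close>: edges of the graph get color 1, the remaining
    pairs color 2.\<close>
  define D where "D = (\<lambda>E. \<lambda>e\<in>nsets {1..n} 2. if e \<in> E then 1 else (2::nat))"
  have colors: "c e = 1 \<or> c e = 2" if "c \<in> edge_colorings 2 n" "e \<in> nsets {1..n} 2" for c e
    using that PiE_mem[of c "nsets {1..n} 2" "\<lambda>_. {1..2}" e] by (auto simp: edge_colorings_def)
  have good_iff: "\<not> has_mono_copy 2 (complete_pair r s) n c \<longleftrightarrow> F c \<in> ramsey_graphs n r s"
    if c: "c \<in> edge_colorings 2 n" for c
  proof -
    have "clique A (F c) \<longleftrightarrow> (\<forall>e\<in>nsets A 2. c e = 1)"
      "indep A (F c) \<longleftrightarrow> (\<forall>e\<in>nsets A 2. c e = 2)" if "A \<subseteq> {1..n}" for A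
      using nsets_mono[OF that, of 2] colors[OF c]
      unfolding clique_iff_nsets indep_iff_nsets F_def by force+
    then have "(\<exists>A\<subseteq>{1..n}. card A = r \<and> (\<forall>e\<in>nsets A 2. c e = 1))
        \<longleftrightarrow> (\<exists>A\<subseteq>{1..n}. card A = r \<and> clique A (F c))"
      "(\<exists>A\<subseteq>{1..n}. card A = s \<and> (\<forall>e\<in>nsets A 2. c e = 2))
        \<longleftrightarrow> (\<exists>A\<subseteq>{1..n}. card A = s \<and> indep A (F c))"
      by blast+
    moreover have "F c \<subseteq> nsets {1..n} 2" by (auto simp: F_def)
    ultimately show ?thesis
      unfolding has_mono_copy_complete_pair ramsey_graphs_def by blast
  qed
  have DC: "D E \<in> edge_colorings 2 n" for E
    by (auto simp: D_def edge_colorings_def)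
  have FD: "F (D E) = E" if "E \<subseteq> nsets {1..n} 2" for E
    using that by (auto simp: F_def D_def)
  have DF: "D (F c) = c" if c: "c \<in> edge_colorings 2 n" for c
  proof
    fix e
    show "D (F c) e = c e"
    proof (cases "e \<in> nsets {1..n} 2")
      case True
      then have "D (F c) e = (if c e = 1 then 1 else 2)"
        unfolding D_def F_def by simp
      then show ?thesis using colors[OF c True] by presburger
    next
      case False
      then show ?thesis using c PiE_arb[of c "nsets {1..n} 2" _ e]
        unfolding D_def edge_colorings_def edges_complete_graph by simp
    qed
  qed
  have "bij_betw F (good_colorings 2 (complete_pair r s) n) (ramsey_graphs n r s)"
  proof (rule bij_betw_byWitness[where f' = D])
    show FD': "\<forall>E\<in>ramsey_graphs n r s. F (D E) = E"
      using FD by (simp add: ramsey_graphs_def)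
    show "D ` ramsey_graphs n r s \<subseteq> good_colorings 2 (complete_pair r s) n"
    proof (rule image_subsetI)
      fix E assume "E \<in> ramsey_graphs n r s"
      then have "F (D E) \<in> ramsey_graphs n r s" by (simp only: FD')
      then show "D E \<in> good_colorings 2 (complete_pair r s) n"
        unfolding good_colorings_def mem_Collect_eq using good_iff[OF DC, of E] DC by blast
    qed
  qed (use good_iff DF in \<open>auto simp: good_colorings_def\<close>)
  then show ?thesis by (simp add: F_def)
qed

subsection \<open>Ramsey ideals\<close>

lemma ramsey_systemE:
  assumes "f \<in> ramsey_system k G n"
  obtains H i where "f = p_poly H i" "i \<in> {1..k}" "H \<in> copies n (G i)"
    | e where "f = q_poly k e" "e \<in> nsets {1..n} 2"
    | i j e where "f = u_poly i j e" "i \<in> {1..k}" "j \<in> {1..k}" "i \<noteq> j" "e \<in> nsets {1..n} 2"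
  using assms unfolding ramsey_system_def edges_complete_graph
  by (elim UnE CollectE exE conjE) blast+

text \<open>Needed for \<open>genideal\<close> to be an ideal that contains its generators.\<close>

lemma ramsey_system_closed: "ramsey_system k G n \<subseteq> carrier (mpoly_ring (ramsey_vars k n))"
proof
  have V: "Var (i, e) \<in> carrier (mpoly_ring (ramsey_vars k n) :: (rvar, F2bar) mpoly ring)"
    if "i \<in> {1..k}" "e \<in> nsets {1..n} 2" for i e
    using that by (intro Var_closed) (simp add: ramsey_vars_def)
  have one: "1 \<in> carrier (mpoly_ring (ramsey_vars k n) :: (rvar, F2bar) mpoly ring)"
    by simp
  fix f assume "f \<in> ramsey_system k G n"
  then consider (p) H i where "f = p_poly H i" "i \<in> {1..k}" "H \<in> copies n (G i)"
    | (q) e where "f = q_poly k e" "e \<in> nsets {1..n} 2"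
    | (u) i j e where "f = u_poly i j e" "i \<in> {1..k}" "j \<in> {1..k}" "i \<noteq> j" "e \<in> nsets {1..n} 2"
    by (rule ramsey_systemE)
  then show "f \<in> carrier (mpoly_ring (ramsey_vars k n))"
  proof cases
    case p
    then show ?thesis unfolding p(1) p_poly_def
      using copies_edges(1)[OF p(3)] by (intro mpoly_ring_prod_closed V) blast+
  next
    case q
    then show ?thesis unfolding q(1) q_poly_def
      by (intro mpoly_ring_add_closed mpoly_ring_sum_closed one V)
  next
    case u
    then show ?thesis unfolding u(1) u_poly_def
      by (intro mpoly_ring_mult_closed V)
  qed
qed

lemma p_poly_multiple:
  assumes "e' \<subseteq> e" "e \<subseteq> nsets {1..n} 2" "i \<in> {1..k}"
  shows "\<exists>f\<in>carrier (mpoly_ring (ramsey_vars k n)). p_poly (A, e) i = f * p_poly (A', e') i"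
proof
  have "finite e" using assms(2) finite_imp_finite_nsets[of "{1..n}" 2] finite_subset by blast
  then show "p_poly (A, e) i = (\<Prod>d\<in>e - e'. Var (i, d)) * p_poly (A', e') i"
    using assms(1) by (simp add: p_poly_def prod.subset_diff)
  show "(\<Prod>d\<in>e - e'. Var (i, d)) \<in> carrier (mpoly_ring (ramsey_vars k n) :: (rvar, F2bar) mpoly ring)"
    by (intro mpoly_ring_prod_closed Var_closed) (use assms in \<open>auto simp: ramsey_vars_def\<close>)
qed

text \<open>By minimality of the generated ideal it suffices to place the generators of the smaller
  ideal in the larger one. The two systems share their \<open>q_poly\<close> and
  \<open>u_poly\<close> parts; the \<open>p_poly\<close> of a larger clique is a multiple of that of
  a clique inside it.\<close>

lemma RI_antimono:
  assumes "r \<le> r'" "s \<le> s'"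
  shows "RI n r' s' \<subseteq> RI n r s"
proof -
  let ?R = "mpoly_ring (ramsey_vars 2 n) :: (rvar, F2bar) mpoly ring"
  interpret cring ?R by (rule mpoly_ring_cring)
  have ideal: "ideal (RI n r s) ?R"
    unfolding RI_def by (rule genideal_ideal[OF ramsey_system_closed])
  have gen: "ramsey_system 2 (complete_pair r s) n \<subseteq> RI n r s"
    unfolding RI_def by (rule genideal_self[OF ramsey_system_closed])
  have "p_poly H i \<in> RI n r s"
    if i: "i \<in> {1..2}" and H: "H \<in> copies n (complete_pair r' s' i)" for H i
  proof -
    define m m' where "m = (if i = 1 then r else s)" and "m' = (if i = 1 then r' else s')"
    have "m \<le> m'" using assms by (simp add: m_def m'_def)
    have pair: "complete_pair r s i = complete_graph m" "complete_pair r' s' i = complete_graph m'"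
      by (simp_all add: m_def m'_def complete_pair_def)
    obtain A where A: "H = (A, nsets A 2)" "A \<subseteq> {1..n}" "card A = m'"
      using H by (auto simp: pair copies_complete_graph nsets_def)
    \<comment> \<open>Any \<open>m\<close> vertices of the larger clique span a copy for the smaller
      parameter.\<close>
    obtain B where B: "B \<subseteq> A" "card B = m" "finite B"
      using obtain_subset_with_card_n[of m A] \<open>m \<le> m'\<close> A(3) by auto
    have "(B, nsets B 2) \<in> copies n (complete_pair r s i)"
      using A B by (auto simp: pair copies_complete_graph nsets_def)
    then have "p_poly (B, nsets B 2) i \<in> RI n r s"
      using gen i unfolding ramsey_system_def by blast
    moreover obtain f where "f \<in> carrier ?R" "p_poly H i = f * p_poly (B, nsets B 2) i"
      using p_poly_multiple[of "nsets B 2" "nsets A 2" n i 2 A B] nsets_mono[OF A(2)]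
        nsets_mono[OF B(1)] i A(1) by auto
    ultimately show ?thesis
      using ideal.I_l_closed[OF ideal, of "p_poly (B, nsets B 2) i" f]
      by (simp only: mpoly_ring_simps(2))
  qed
  then have "ramsey_system 2 (complete_pair r' s') n \<subseteq> RI n r s"
    using gen unfolding ramsey_system_def by (simp only: Un_subset_iff) blast
  then show ?thesis
    unfolding RI_def[of n r' s'] by (rule genideal_minimal[OF ideal])
qed

section \<open>Stabilization of the ideals once the clique size exceeds \<open>n\<close>\<close>

lemma copies_complete_graph_empty: "n < m \<Longrightarrow> copies n (complete_graph m) = {}"
  by (simp add: copies_complete_graph nsets_eq_empty_iff)

lemma RI_cong_copies:
  assumes "\<And>i. i \<in> {1..2} \<Longrightarrow> copies n (complete_pair r s i) = copies n (complete_pair r' s' i)"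
  shows "RI n r s = RI n r' s'"
proof -
  have "ramsey_system 2 (complete_pair r s) n = ramsey_system 2 (complete_pair r' s') n"
    unfolding ramsey_system_def using assms by blast
  then show ?thesis by (simp add: RI_def)
qed

theorem theorem1:
  fixes k n r s :: nat and G :: "nat \<Rightarrow> 'a ugraph"
  assumes "k \<ge> 1" and "n \<ge> 1" and "\<And>i. i \<in> {1..k} \<Longrightarrow> simple_graph (G i)"
  shows "(ramsey_number k G \<le> n \<longleftrightarrow> ramsey_solutions k G n = {}) \<and>
    (ramsey_solutions k G n \<noteq> {} \<longrightarrow>
      finite (ramsey_solutions k G n) \<and>
      card (ramsey_solutions k G n) = card (good_colorings k G n)) \<and>
    (finite (ramsey_solutions 2 (complete_pair r s) n) \<and>
      card (ramsey_solutions 2 (complete_pair r s) n) = RG n r s) \<and>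
    (\<forall>m. r \<le> m \<and> m \<le> n \<longrightarrow> RI n m s \<supseteq> RI n (m + 1) s) \<and>
    (\<forall>m. m \<ge> n + 1 \<longrightarrow> RI n m s = RI n (m + 1) s) \<and>
    (\<forall>m. s \<le> m \<and> m \<le> n \<longrightarrow> RI n r m \<supseteq> RI n r (m + 1)) \<and>
    (\<forall>m. m \<ge> n + 1 \<longrightarrow> RI n r m = RI n r (m + 1))"
proof (intro conjI allI impI)
  show "ramsey_number k G \<le> n \<longleftrightarrow> ramsey_solutions k G n = {}"
    using ramsey_number_le_iff[of n k G] assms(2,3)
      bij_betw_imp_surj_on[OF bij_betw_coloring_point[of k n G]] by auto
  show "finite (ramsey_solutions k G n)" "finite (ramsey_solutions 2 (complete_pair r s) n)"
    using bij_betw_coloring_point finite_good_colorings bij_betw_finite by blast+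
  show "card (ramsey_solutions k G n) = card (good_colorings k G n)"
    using bij_betw_same_card[OF bij_betw_coloring_point] by metis
  \<comment> \<open>Good colorings mediate: they biject with the solutions on one side and with the
    Ramsey graphs on the other.\<close>
  show "card (ramsey_solutions 2 (complete_pair r s) n) = RG n r s"
    unfolding RG_def
    using bij_betw_same_card[OF bij_betw_coloring_point[of 2 n "complete_pair r s"]]
      bij_betw_same_card[OF bij_betw_color_class[of n r s]] by simp
  show "RI n (m + 1) s \<subseteq> RI n m s" for m
    by (rule RI_antimono) simp_all
  show "RI n r (m + 1) \<subseteq> RI n r m" for m
    by (rule RI_antimono) simp_all
  show "RI n m s = RI n (m + 1) s" if "n + 1 \<le> m" for m
    by (rule RI_cong_copies) (use that in \<open>simp add: complete_pair_def copies_complete_graph_empty\<close>)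
  show "RI n r m = RI n r (m + 1)" if "n + 1 \<le> m" for m
    by (rule RI_cong_copies) (use that in \<open>simp add: complete_pair_def copies_complete_graph_empty\<close>)
qed

end
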